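(* Let $\boldsymbol{X}_1,\ldots,\boldsymbol{X}_n$ be a sample of $d$-variate vectors without ties in any of the $d$ components. Then all $d$ univariate margins of the empirical beta copula $\mathbb{C}_n^\beta$ of the sample are equal to the uniform distribution on $[0,1]$, and $\mathbb{C}_n^\beta$ is a copula.
   Context: For $\boldsymbol{X}_i=(X_{i,1},\ldots,X_{i,d})$, "without ties in any of the $d$ components" means that for each $j$ the numbers $X_{1,j},\ldots,X_{n,j}$ are pairwise distinct. The ranks are $R_{i,j}^{(n)}=\sum_{k=1}^n\mathbf{1}\{X_{k,j}\le X_{i,j}\}$. The empirical beta copula is $$\mathbb{C}_n^\beta(\boldsymbol{u})=\frac1n\sum_{i=1}^n\prod_{j=1}^d F_{n,R_{i,j}^{(n)}}(u_j),\qquad \boldsymbol{u}\in[0,1]^d,$$ where $F_{n,r}(u)=\sum_{s=r}^n\binom{n}{s}u^s(1-u)^{n-s}$ ($u\in[0,1]$, $r\in\{1,\ldots,n\}$) is the cumulative distribution function of the beta distribution $\mathcal{B}(r,n+1-r)$. A copula is (the restriction to $[0,1]^d$ of) the cumulative distribution function of a probability distribution on $[0,1]^d$ all of whose one-dimensional margins are uniform on $[0,1]$; equivalently, a function $C:[0,1]^d\to[0,1]$ that vanishes when some $u_j=0$, satisfies $C(1,\ldots,1,u_j,1,\ldots,1)=u_j$ for all $j$, and is $d$-increasing (assigns nonnegative volume to every box). *)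

theory Defs
  imports "HOL-Probability.Probability"
begin

definition uniform01 :: "real measure" where
  "uniform01 = uniform_measure lborel {0..1}"

text \<open>The order on \<^typ>\<open>real^'d\<close> is componentwise, so \<open>measure M {..u}\<close> below is the multivariate
  cumulative distribution function of \<open>M\<close> at \<open>u\<close>, and \<open>cbox 0 1\<close> is the unit cube. Only the values
  of \<open>C\<close> on the unit cube are constrained.\<close>

definition copula :: "(real^'d \<Rightarrow> real) \<Rightarrow> bool" where
  "copula C \<longleftrightarrow>
     (\<exists>M :: (real^'d) measure.
        prob_space M \<and> sets M = sets borel \<and> measure M (cbox 0 1) = 1 \<and>
        (\<forall>j. distr M borel (\<lambda>x. x $ j) = uniform01) \<and>
        (\<forall>u\<in>cbox 0 1. C u = measure M {..u}))"

definition margin :: "(real^'d \<Rightarrow> real) \<Rightarrow> 'd \<Rightarrow> real \<Rightarrow> real" where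
  "margin C j t = C (\<chi> k. if k = j then t else 1)"

definition no_ties :: "nat \<Rightarrow> (nat \<Rightarrow> real^'d) \<Rightarrow> bool" where
  "no_ties n X \<longleftrightarrow> (\<forall>j. inj_on (\<lambda>i. X i $ j) {1..n})"

definition sample_rank :: "nat \<Rightarrow> (nat \<Rightarrow> real^'d) \<Rightarrow> nat \<Rightarrow> 'd \<Rightarrow> nat" where
  "sample_rank n X i j = (\<Sum>k=1..n. of_bool (X k $ j \<le> X i $ j))"

text \<open>For \<open>1 \<le> r \<le> n\<close>, on the unit interval, this is the cumulative distribution function of the beta
  distribution with parameters \<open>r\<close> and \<open>n + 1 - r\<close>.\<close>

definition beta_cdf :: "nat \<Rightarrow> nat \<Rightarrow> real \<Rightarrow> real" where
  "beta_cdf n r t = (\<Sum>s=r..n. real (n choose s) * t ^ s * (1 - t) ^ (n - s))"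

definition empirical_beta_copula :: "nat \<Rightarrow> (nat \<Rightarrow> real^'d) \<Rightarrow> real^'d \<Rightarrow> real" where
  "empirical_beta_copula n X u =
     (1 / real n) * (\<Sum>i=1..n. \<Prod>j\<in>UNIV. beta_cdf n (sample_rank n X i j) (u $ j))"

end

theory Submission
  imports Defs
begin

text \<open>Each \<open>beta_cdf n r\<close> is a distribution function, so the empirical beta copula is the distribution
  function of the uniform mixture over \<open>i\<close> of the product laws with beta margins. Without ties the
  ranks of the \<open>j\<close>-th components are a permutation of \<open>1, \<dots>, n\<close>, so the \<open>j\<close>-th margin is the average
  of all \<open>beta_cdf n r\<close>, which is the mean of the binomial distribution divided by \<open>n\<close>.\<close>

subsection \<open>Beta distribution functions\<close>

lemma beta_cdf_0:
  assumes "1 \<le> r"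
  shows "beta_cdf n r 0 = 0"
  unfolding beta_cdf_def using assms by (intro sum.neutral) auto

lemma beta_cdf_1:
  assumes "r \<le> n"
  shows "beta_cdf n r 1 = 1"
proof -
  have "beta_cdf n r 1 = (\<Sum>s=r..n. if s = n then 1 else 0)"
    unfolding beta_cdf_def by (intro sum.cong) auto
  then show ?thesis
    using assms by simp
qed

text \<open>The derivatives of the summands telescope and only the contribution of the lowest index
  survives. On the unit interval the result is the beta density, since
  \<open>r * (n choose r)\<close> is the reciprocal of the beta function at
  \<open>(r, n + 1 - r)\<close>.\<close>

lemma has_real_derivative_beta_cdf:
  assumes "1 \<le> r" "r \<le> n"
  shows "(beta_cdf n r has_real_derivative
           real r * real (n choose r) * t ^ (r - 1) * (1 - t) ^ (n - r)) (at t)"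
proof -
  define h where "h s = real s * real (n choose s) * t ^ (s - 1) * (1 - t) ^ (n - s)" for s
  have deriv: "((\<lambda>t. real (n choose s) * t ^ s * (1 - t) ^ (n - s)) has_real_derivative
      - (h (Suc s) - h s)) (at t)" if "s \<in> {r..n}" for s
  proof -
    \<comment> \<open>Both sides are \<open>n\<close> times a binomial coefficient of
      \<open>n - 1\<close>. This identifies what comes from differentiating
      \<open>(1 - t) ^ (n - s)\<close> with \<open>h (Suc s)\<close>.\<close>
    have "(n - s) * (n choose s) = Suc s * (n choose Suc s)"
      by (metis binomial_absorb_comp binomial_absorption)
    then have eq: "real (n - s) * real (n choose s) = real (Suc s) * real (n choose Suc s)"
      by (metis of_nat_mult)
    have h_Suc: "h (Suc s) = real (n - s) * real (n choose s) * t ^ s * (1 - t) ^ (n - s - 1)"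
      unfolding h_def eq by simp
    show ?thesis
      unfolding h_Suc unfolding h_def
      by (rule derivative_eq_intros refl | simp add: algebra_simps)+
  qed
  have "((\<lambda>t. \<Sum>s=r..n. real (n choose s) * t ^ s * (1 - t) ^ (n - s)) has_real_derivative
      (\<Sum>s=r..n. - (h (Suc s) - h s))) (at t)"
    using deriv by (rule DERIV_sum)
  \<comment> \<open>The upper end \<open>h (Suc n)\<close> vanishes because
    \<open>n choose Suc n\<close> is 0.\<close>
  moreover have "(\<Sum>s=r..n. - (h (Suc s) - h s)) = h r"
    using assms by (simp only: sum_negf sum_Suc_diff) (simp add: h_def)
  ultimately show ?thesis
    unfolding h_def beta_cdf_def[abs_def] by simp
qed

lemma beta_cdf_mono:
  assumes "1 \<le> r" "r \<le> n" "0 \<le> x" "x \<le> y" "y \<le> 1"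
  shows "beta_cdf n r x \<le> beta_cdf n r y"
proof (rule DERIV_nonneg_imp_nondecreasing[OF \<open>x \<le> y\<close>])
  fix t assume "x \<le> t" "t \<le> y"
  then show "\<exists>d. (beta_cdf n r has_real_derivative d) (at t) \<and> 0 \<le> d"
    using assms by (intro exI[of _ "real r * real (n choose r) * t ^ (r - 1) * (1 - t) ^ (n - r)"]
        conjI has_real_derivative_beta_cdf) auto
qed

text \<open>The polynomial is monotone only on the unit interval. Clamping its argument extends it
  continuously by 0 on the left and by 1 on the right, so that it is the distribution function of an
  interval measure.\<close>

lemma exists_distribution_beta_cdf:
  assumes "1 \<le> r" "r \<le> n"
  shows "\<exists>B. real_distribution B \<and> (\<forall>t. cdf B t = beta_cdf n r (max 0 (min 1 t)))"
proof -
  let ?F = "\<lambda>t. beta_cdf n r (max 0 (min 1 t))"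
  have mono: "?F x \<le> ?F y" if "x \<le> y" for x y
    using that by (intro beta_cdf_mono assms) auto
  have "continuous_on UNIV ?F"
    unfolding beta_cdf_def by (intro continuous_intros)
  then have right: "continuous (at_right a) ?F" for a
    by (meson UNIV_I continuous_on_eq_continuous_at continuous_within_subset open_UNIV subset_UNIV)
  have bot: "(?F \<longlongrightarrow> 0) at_bot"
  proof (rule tendsto_eventually)
    show "\<forall>\<^sub>F t in at_bot. ?F t = 0"
      using eventually_le_at_bot[of 0] by eventually_elim (use assms in \<open>simp add: beta_cdf_0\<close>)
  qed
  have top: "(?F \<longlongrightarrow> 1) at_top"
  proof (rule tendsto_eventually)
    show "\<forall>\<^sub>F t in at_top. ?F t = 1"
      using eventually_ge_at_top[of 1] by eventually_elim (use assms in \<open>simp add: beta_cdf_1\<close>)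
  qed
  show ?thesis
    using real_distribution_interval_measure[OF mono right bot top]
      cdf_interval_measure[OF mono right bot] by (intro exI[of _ "interval_measure ?F"]) auto
qed

text \<open>After the order of summation is exchanged, the \<open>s\<close>-th Bernstein term is
  counted once for each \<open>r\<close> from 1 to \<open>s\<close>, hence with weight
  \<open>s\<close>.\<close>

lemma sum_beta_cdf: "(\<Sum>r=1..n. beta_cdf n r t) = real n * t"
proof -
  have "(\<Sum>r=1..n. beta_cdf n r t) = (\<Sum>r=1..n. \<Sum>s=r..n. Bernstein n s t)"
    by (simp add: beta_cdf_def Bernstein_def)
  also have "\<dots> = (\<Sum>r=1..n. \<Sum>s | s \<in> {1..n} \<and> r \<le> s. Bernstein n s t)"
    by (intro sum.cong) auto
  also have "\<dots> = (\<Sum>s=1..n. \<Sum>r | r \<in> {1..n} \<and> r \<le> s. Bernstein n s t)"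
    by (rule sum.swap_restrict) simp_all
  also have "\<dots> = (\<Sum>s=1..n. \<Sum>r=1..s. Bernstein n s t)"
    by (intro sum.cong) auto
  also have "\<dots> = (\<Sum>s=1..n. real s * Bernstein n s t)"
    by simp
  \<comment> \<open>The added index 0 has weight 0. The full sum is the binomial mean.\<close>
  also have "\<dots> = (\<Sum>s\<le>n. real s * Bernstein n s t)"
    by (intro sum.mono_neutral_left) auto
  finally show ?thesis
    by simp
qed

subsection \<open>Ranks\<close>

lemma sample_rank_eq_card: "sample_rank n X i j = card {k \<in> {1..n}. X k $ j \<le> X i $ j}"
  by (simp add: sample_rank_def Int_def flip: sum.inter_filter)

text \<open>Ranks respect the strict order of the components, so without ties they are injective,
  and an injective self-map of a finite set is onto.\<close>

lemma bij_betw_sample_rank: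
  assumes "no_ties n X"
  shows "bij_betw (\<lambda>i. sample_rank n X i j) {1..n} {1..n}"
proof -
  have less: "sample_rank n X i j < sample_rank n X k j"
    if "k \<in> {1..n}" "X i $ j < X k $ j" for i k
  proof -
    \<comment> \<open>The index \<open>k\<close> counts towards its own rank but not towards that of
      \<open>i\<close>, which makes the inclusion strict.\<close>
    have "k \<in> {l \<in> {1..n}. X l $ j \<le> X k $ j} - {l \<in> {1..n}. X l $ j \<le> X i $ j}"
      using that by auto
    moreover have "{l \<in> {1..n}. X l $ j \<le> X i $ j} \<subseteq> {l \<in> {1..n}. X l $ j \<le> X k $ j}"
      using that by auto
    ultimately show ?thesis
      unfolding sample_rank_eq_card by (intro psubset_card_mono) (simp, blast)
  qed
  have "inj_on (\<lambda>i. sample_rank n X i j) {1..n}"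
  proof (rule inj_onI)
    fix i k
    assume ik: "i \<in> {1..n}" "k \<in> {1..n}" and eq: "sample_rank n X i j = sample_rank n X k j"
    have "X i $ j = X k $ j"
      using less[OF ik(1), of k] less[OF ik(2), of i] eq by (metis less_irrefl linorder_less_linear)
    with ik show "i = k"
      using assms unfolding no_ties_def by (meson inj_onD)
  qed
  moreover have "(\<lambda>i. sample_rank n X i j) ` {1..n} \<subseteq> {1..n}"
  proof
    fix r assume "r \<in> (\<lambda>i. sample_rank n X i j) ` {1..n}"
    then obtain i where i: "i \<in> {1..n}" and r: "r = sample_rank n X i j"
      by auto
    have "card {k \<in> {1..n}. X k $ j \<le> X i $ j} \<le> card {1..n}"
      by (intro card_mono) auto
    moreover have "card {k \<in> {1..n}. X k $ j \<le> X i $ j} > 0"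
      using i by (subst card_gt_0_iff) auto
    ultimately show "r \<in> {1..n}"
      by (simp add: r sample_rank_eq_card)
  qed
  ultimately show ?thesis
    by (simp add: bij_betw_def endo_inj_surj)
qed

lemma sum_beta_cdf_sample_rank:
  assumes "no_ties n X"
  shows "(\<Sum>i=1..n. beta_cdf n (sample_rank n X i j) t) = real n * t"
  using sum.reindex_bij_betw[OF bij_betw_sample_rank[OF assms], of "\<lambda>r. beta_cdf n r t"]
  by (simp only: sum_beta_cdf)

subsection \<open>Product laws and mixtures\<close>

lemma borel_measurable_vec_nth: "(\<lambda>x :: real^'d. x $ j) \<in> borel_measurable borel"
  by (intro borel_measurable_continuous_onI continuous_on_component continuous_on_id)

text \<open>The law of a vector with independent coordinates: the product measure on functions is
  pushed forward to vectors. Arbitrary Borel sides cover both the half-spaces needed for the margins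
  and the lower orthants needed for the joint distribution function.\<close>

lemma exists_product_measure_vec:
  fixes N :: "'d::finite \<Rightarrow> real measure"
  assumes "\<And>j. real_distribution (N j)"
  shows "\<exists>P :: (real^'d) measure. prob_space P \<and> sets P = sets borel \<and>
    (\<forall>A. (\<forall>j. A j \<in> sets borel) \<longrightarrow> measure P {x. \<forall>j. x $ j \<in> A j} = (\<Prod>j\<in>UNIV. measure (N j) (A j)))"
proof -
  interpret N: real_distribution "N j" for j
    by (rule assms)
  interpret finite_product_prob_space N UNIV
    by unfold_locales auto
  let ?f = "\<lambda>g :: 'd \<Rightarrow> real. \<chi> j. g j"
  have f: "?f \<in> borel_measurable (PiM UNIV N)"
    by (subst borel_measurable_euclidean_space)
       (auto simp: Basis_vec_def inner_axis intro!: measurable_PiM_component_rev)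
  have "measure (distr (PiM UNIV N) borel ?f) {x. \<forall>j. x $ j \<in> A j} = (\<Prod>j\<in>UNIV. measure (N j) (A j))"
    if A: "\<And>j. A j \<in> sets borel" for A
  proof -
    have "{x :: real^'d. \<forall>j. x $ j \<in> A j} = (\<Inter>j. (\<lambda>x. x $ j) -` A j)"
      by auto
    also have "\<dots> \<in> sets borel"
    proof (intro sets.finite_INT)
      show "(\<lambda>x :: real^'d. x $ j) -` A j \<in> sets borel" for j
        using measurable_sets[OF borel_measurable_vec_nth A[of j]] by simp
    qed auto
    finally have "{x :: real^'d. \<forall>j. x $ j \<in> A j} \<in> sets borel" .
    then have "measure (distr (PiM UNIV N) borel ?f) {x. \<forall>j. x $ j \<in> A j} =
        measure (PiM UNIV N) (Pi\<^sub>E UNIV A)"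
      by (subst measure_distr[OF f]) (auto intro!: arg_cong[where f="measure _"] simp: space_PiM PiE_def)
    also have "\<dots> = (\<Prod>j\<in>UNIV. measure (N j) (A j))"
      using A by (intro prob_times) auto
    finally show ?thesis .
  qed
  then show ?thesis
    using prob_space_distr[OF f] by (intro exI[of _ "distr (PiM UNIV N) borel ?f"]) auto
qed

text \<open>Draw an index uniformly from \<open>I\<close>, then a point from the law with that
  index; the monadic bind expresses this two-stage experiment.\<close>

lemma exists_uniform_mixture:
  assumes I: "finite I" "I \<noteq> {}"
    and P: "\<And>i. i \<in> I \<Longrightarrow> prob_space (P i)" "\<And>i. i \<in> I \<Longrightarrow> sets (P i) = sets S"
  shows "\<exists>M. prob_space M \<and> sets M = sets S \<and>
    (\<forall>A\<in>sets S. measure M A = (\<Sum>i\<in>I. measure (P i) A) / real (card I))"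
proof -
  obtain i0 where "i0 \<in> I"
    using I by auto
  \<comment> \<open>A kernel must be a probability law at every index of the type. The default
    \<open>P i0\<close> outside \<open>I\<close> has no effect, as those indices have mass
    0.\<close>
  define Q where "Q i = (if i \<in> I then P i else P i0)" for i
  have Q: "prob_space (Q i)" "sets (Q i) = sets S" for i
    using P \<open>i0 \<in> I\<close> by (auto simp: Q_def)
  have meas: "Q \<in> measurable (measure_pmf (pmf_of_set I)) (subprob_algebra S)"
    using Q by (auto simp: space_subprob_algebra prob_space_imp_subprob_space)
  let ?M = "measure_pmf (pmf_of_set I) \<bind> Q"
  have "prob_space ?M"
    using Q(1) by (intro prob_space.prob_space_bind[OF _ _ meas] measure_pmf.prob_space_axioms) auto
  moreover have "sets ?M = sets S"
    using Q(2) by (intro sets_bind) auto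
  moreover have "measure ?M A = (\<Sum>i\<in>I. measure (P i) A) / real (card I)" if "A \<in> sets S" for A
    using I measure_pmf.measure_bind[OF meas that]
    by (simp add: integral_pmf_of_set Q_def)
  ultimately show ?thesis
    by blast
qed

text \<open>The clamp is the one in \<open>exists_distribution_beta_cdf\<close>, so margins can be
  compared at every real \<open>t\<close>.\<close>

lemma cdf_uniform01: "cdf uniform01 t = max 0 (min 1 t)"
proof -
  have "{0..1} \<inter> {..t} = {0..min 1 t}"
    by auto
  then show ?thesis
    by (simp add: cdf_def uniform01_def)
qed

lemma real_distribution_uniform01: "real_distribution uniform01"
  unfolding uniform01_def by (intro real_distribution.intro prob_space_uniform_measure
      real_distribution_axioms.intro) auto

theorem mainTheorem3:
  fixes n :: nat and X :: "nat \<Rightarrow> real^'d"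
  assumes "n \<ge> 1"
    and "no_ties n X"
  shows "(\<forall>j. \<forall>t\<in>{0..1}. margin (empirical_beta_copula n X) j t = cdf uniform01 t)
         \<and> copula (empirical_beta_copula n X)"
proof
  let ?R = "sample_rank n X"
  have R: "1 \<le> ?R i j" "?R i j \<le> n" if "i \<in> {1..n}" for i j
    using bij_betwE[OF bij_betw_sample_rank[OF assms(2), of j]] that by auto
  show "\<forall>j. \<forall>t\<in>{0..1}. margin (empirical_beta_copula n X) j t = cdf uniform01 t"
  proof (intro allI ballI)
    fix j and t :: real assume t: "t \<in> {0..1}"
    \<comment> \<open>The other factors are evaluated at 1, where they equal 1 because ranks are at
      most \<open>n\<close>.\<close>
    have "(\<Prod>k\<in>UNIV. beta_cdf n (?R i k) ((\<chi> k. if k = j then t else 1) $ k)) = beta_cdf n (?R i j) t"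
      if "i \<in> {1..n}" for i
    proof -
      have "(\<Prod>k\<in>UNIV. beta_cdf n (?R i k) ((\<chi> k. if k = j then t else 1) $ k)) =
          (\<Prod>k\<in>UNIV. if k = j then beta_cdf n (?R i j) t else 1)"
        using R[OF that] by (intro prod.cong) (auto simp: beta_cdf_1)
      then show ?thesis
        by simp
    qed
    then have "margin (empirical_beta_copula n X) j t = (1 / real n) * (real n * t)"
      unfolding margin_def empirical_beta_copula_def sum_beta_cdf_sample_rank[OF assms(2), of j t, symmetric]
      by simp
    then show "margin (empirical_beta_copula n X) j t = cdf uniform01 t"
      using assms(1) t by (simp add: cdf_uniform01)
  qed
  \<comment> \<open>For each observation \<open>i\<close>, \<open>B i j\<close> is the beta law
    given by its \<open>j\<close>-th rank, \<open>P i\<close> is the product of these laws over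
    \<open>j\<close>, and \<open>M\<close> is the uniform mixture of the \<open>P i\<close>.\<close>
  have "\<exists>B. real_distribution B \<and> (\<forall>t. cdf B t = beta_cdf n (?R i j) (max 0 (min 1 t)))"
    if "i \<in> {1..n}" for i j
    using R[OF that] by (rule exists_distribution_beta_cdf)
  then obtain B where B: "\<And>i j. i \<in> {1..n} \<Longrightarrow> real_distribution (B i j)"
      "\<And>i j t. i \<in> {1..n} \<Longrightarrow> cdf (B i j) t = beta_cdf n (?R i j) (max 0 (min 1 t))"
    by metis
  have "\<forall>i\<in>{1..n}. \<exists>P :: (real^'d) measure. prob_space P \<and> sets P = sets borel \<and>
      (\<forall>A. (\<forall>j. A j \<in> sets borel) \<longrightarrow>
        measure P {x. \<forall>j. x $ j \<in> A j} = (\<Prod>j\<in>UNIV. measure (B i j) (A j)))"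
    using B(1) by (blast intro!: exists_product_measure_vec)
  from bchoice[OF this] obtain P :: "nat \<Rightarrow> (real^'d) measure" where
    P: "\<And>i. i \<in> {1..n} \<Longrightarrow> prob_space (P i)" "\<And>i. i \<in> {1..n} \<Longrightarrow> sets (P i) = sets borel"
      and P_box: "\<And>i A. i \<in> {1..n} \<Longrightarrow> (\<And>j. A j \<in> sets borel) \<Longrightarrow>
        measure (P i) {x. \<forall>j. x $ j \<in> A j} = (\<Prod>j\<in>UNIV. measure (B i j) (A j))"
    by blast
  obtain M where M: "prob_space M" "sets M = sets (borel :: (real^'d) measure)"
    and M_eq: "\<And>A. A \<in> sets borel \<Longrightarrow> measure M A = (\<Sum>i=1..n. measure (P i) A) / real n"
    using exists_uniform_mixture[of "{1..n}" P borel] P assms(1) by auto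
  interpret M: prob_space M
    by (rule M(1))
  have [measurable_cong]: "sets M = sets borel"
    by (rule M(2))
  have space_M: "space M = UNIV"
    using sets_eq_imp_space_eq[OF M(2)] by simp
  have component [measurable]: "(\<lambda>x :: real^'d. x $ j) \<in> borel_measurable M" for j
    by (subst measurable_cong_sets[OF M(2) refl]) (rule borel_measurable_vec_nth)
  have margins: "distr M borel (\<lambda>x. x $ j) = uniform01" for j
  proof (rule cdf_unique)
    show "real_distribution (distr M borel (\<lambda>x. x $ j))"
      using component by (rule M.real_distribution_distr)
    show "cdf (distr M borel (\<lambda>x. x $ j)) = cdf uniform01"
    proof
      fix t :: real
      \<comment> \<open>A half-space is a box whose other sides are the whole line, each
        contributing a factor 1.\<close>
      let ?A = "\<lambda>k. if k = j then {..t} else UNIV"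
      have eq: "{x :: real^'d. x $ j \<le> t} = {x. \<forall>k. x $ k \<in> ?A k}"
        by auto
      have "measure (P i) {x. x $ j \<le> t} = beta_cdf n (?R i j) (max 0 (min 1 t))"
        if i: "i \<in> {1..n}" for i
      proof -
        have "measure (B i k) UNIV = 1" for k
          using real_distribution.axioms(1)[OF B(1)[OF i]] real_distribution.space_eq_univ[OF B(1)[OF i]]
          by (metis prob_space.prob_space)
        then have "(\<Prod>k\<in>UNIV. measure (B i k) (?A k)) = (\<Prod>k\<in>UNIV. if k = j then cdf (B i j) t else 1)"
          by (intro prod.cong) (auto simp: cdf_def)
        then show ?thesis
          unfolding eq using i by (subst P_box) (auto simp: B(2))
      qed
      moreover have "{x :: real^'d. x $ j \<le> t} \<in> sets borel"
        by (intro borel_closed closed_Collect_le continuous_intros)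
      \<comment> \<open>The rank sum identity is applied at the clamped value of
        \<open>t\<close>.\<close>
      ultimately have "measure M {x. x $ j \<le> t} = max 0 (min 1 t)"
        using assms(1) sum_beta_cdf_sample_rank[OF assms(2), of j] by (simp add: M_eq)
      then show "cdf (distr M borel (\<lambda>x. x $ j)) t = cdf uniform01 t"
        by (simp add: cdf_def measure_distr space_M vimage_def cdf_uniform01[unfolded cdf_def])
    qed
  qed (rule real_distribution_uniform01)
  \<comment> \<open>Uniform margins already force the support: almost surely each coordinate lies in
    the unit interval, and finitely many such events combine to the cube.\<close>
  have "AE x in M. x $ j \<in> {0..1}" for j
  proof -
    have "AE t in distr M borel (\<lambda>x. x $ j). t \<in> {0..1}"
      unfolding margins uniform01_def by (intro AE_uniform_measureI) auto
    then show ?thesis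
      by (subst (asm) AE_distr_iff) auto
  qed
  then have "AE x in M. x \<in> cbox 0 1"
    by (simp add: mem_box_cart AE_all_countable)
  then have "measure M (cbox 0 1) = 1"
    by (subst M.prob_eq_1) (auto simp: M(2))
  moreover have "empirical_beta_copula n X u = measure M {..u}" if u: "u \<in> cbox 0 1" for u
  proof -
    \<comment> \<open>A lower orthant is a box of half-lines, so its mass under \<open>P i\<close>
      is a product of clamped beta distribution functions; for \<open>u\<close> in the cube the
      clamp is the identity.\<close>
    have eq: "{..u} = {x. \<forall>j. x $ j \<in> {..u $ j}}"
      by (auto simp: less_eq_vec_def)
    have "measure (P i) {..u} = (\<Prod>j\<in>UNIV. beta_cdf n (?R i j) (u $ j))" if i: "i \<in> {1..n}" for i
      unfolding eq P_box[OF i borel_closed[OF closed_atMost]] B(2)[OF i, unfolded cdf_def]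
      using u by (simp add: mem_box_cart)
    moreover have "{..u} \<in> sets borel"
      unfolding eq by (simp add: closed_Collect_all closed_Collect_le continuous_intros)
    ultimately show ?thesis
      by (simp add: M_eq empirical_beta_copula_def)
  qed
  ultimately show "copula (empirical_beta_copula n X)"
    unfolding copula_def using M margins by blast
qed

end
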